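(* There is a constant $q$ with $0<q<1$, namely $q=0.7594\ldots$ (a real number whose decimal expansion begins $0.7594$), such that the following holds. Let $f_0:[0,1]\to\mathbb{R}$ be any twice differentiable function with $f_0(0)=0$ and $f_0(1)=1$, and let the functions $f_1,f_2,\ldots$ on $[0,1]$ be defined by the recursion $$f_{n+1}(x)=\sum_{i=1}^{\infty}\left(f_n\left(\frac{1}{i}\right)-f_n\left(\frac{1}{x+i}\right)\right),\qquad x\in[0,1],\ n\ge 0.$$ Then $$f_n(x)=\frac{\log(x+1)}{\log 2}+\mathcal{O}(q^n),$$ that is, there is a constant $C$ (depending on $f_0$) such that $\left|f_n(x)-\frac{\log(x+1)}{\log 2}\right|\le C q^n$ for all $n\ge 0$ and all $x\in[0,1]$.
   Context: $\log$ denotes the natural logarithm. Differentiability at the endpoints of $[0,1]$ is understood as one-sided.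
   Formalization: The second derivative of f_0 is additionally assumed to be bounded on [0,1] (as it is when f_0 is twice continuously differentiable); for merely twice differentiable f_0 with unbounded second derivative the claim can fail for every q<1. *)

theory Defs
  imports "HOL-Analysis.Analysis"
begin

end

theory Submission imports Defs "HOL-Real_Asymp.Real_Asymp" begin

text \<open>
  Put \<open>g\<^sub>n(x) = (1 + x) f\<^sub>n'(x)\<close>. Differentiating the recursion termwise gives \<open>g\<^sub>n\<^sub>+\<^sub>1 = P g\<^sub>n\<close>, where
  \<open>(P g)(x)\<close> is the mean of \<open>g(1/(x+i))\<close> under the probability weights
  \<open>(1+x)/((x+i)(x+i+1))\<close>, \<open>i \<ge> 1\<close>. The claim is that \<open>g\<^sub>n\<close> tends to a constant geometrically.

  The operator \<open>P\<close> reverses monotonicity: as \<open>x\<close> grows, both the points \<open>1/(x+i)\<close> move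
  left and the weights shift towards larger \<open>i\<close>, so \<open>P\<close> turns decreasing functions into
  increasing ones (\<open>transfer_mono\<close>). Measure the variation of \<open>g\<close> against a decreasing
  reference function \<open>\<phi>\<close>: the bound \<open>\<bar>g x - g y\<bar> \<le> L (\<phi> x - \<phi> y)\<close> for \<open>x \<le> y\<close> says exactly that
  \<open>L \<phi> + g\<close> and \<open>L \<phi> - g\<close> are decreasing. Hence \<open>L P\<phi> + P g\<close> and \<open>L P\<phi> - P g\<close> are increasing, and the
  variation of \<open>P g\<close> is controlled by that of \<open>P \<phi>\<close>. As in Wirsing's treatment of the
  Gauss-Kuzmin problem, \<open>\<phi>\<close> is chosen so that the series for \<open>P \<phi>\<close> telescopes: for
  \<open>\<phi>(x) = 1/(1+2x)\<close> one gets \<open>(P \<phi>)(x) = (1+x)/(2+x)\<close>, whose increments are at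
  most half of those of \<open>\<phi>\<close> in absolute value. So \<open>L\<close> halves in each step
  (\<open>transfer_contracts\<close>), starting from a finite value because \<open>g\<^sub>0\<close> is Lipschitz when
  \<open>f\<^sub>0''\<close> is bounded.

  Since \<open>f\<^sub>n(0) = 0\<close> and \<open>f\<^sub>n(1) = 1\<close> for all \<open>n\<close>, Rolle's theorem applied to
  \<open>f\<^sub>n(x) - log(1+x)/log 2\<close> shows that \<open>g\<^sub>n\<close> takes the value \<open>1/log 2\<close>. Therefore
  \<open>g\<^sub>n\<close> is within \<open>O(2\<^sup>-\<^sup>n)\<close> of that constant, and integrating gives the error \<open>O(2\<^sup>-\<^sup>n)\<close>
  (\<open>deviation_from_log\<close>), which is stronger than the rate \<open>0.7594\<close>.
\<close>

section \<open>The averaging operator on densities\<close>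

definition branch :: "nat \<Rightarrow> real \<Rightarrow> real" where
  "branch i x = 1 / (x + real i + 1)"

text \<open>
  Under the Gauss measure, this is the conditional probability that the first continued fraction
  digit of a number is \<open>i + 1\<close>, given that the Gauss map sends the number to \<open>x\<close>.
\<close>

definition digit_prob :: "nat \<Rightarrow> real \<Rightarrow> real" where
  "digit_prob i x = (1 + x) / ((x + real i + 1) * (x + real i + 2))"

definition transfer :: "(real \<Rightarrow> real) \<Rightarrow> real \<Rightarrow> real" where
  "transfer g x = (\<Sum>i. digit_prob i x * g (branch i x))"

definition ref_fun :: "real \<Rightarrow> real" where
  "ref_fun x = 1 / (1 + 2 * x)"

lemma branch_in_unit: "x \<ge> 0 \<Longrightarrow> branch i x \<in> {0..1}"
  by (auto simp: branch_def field_simps)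

lemma digit_prob_nonneg: "x \<ge> 0 \<Longrightarrow> digit_prob i x \<ge> 0"
  by (simp add: digit_prob_def)

lemma shifted_reciprocals_telescope:
  fixes c x :: real
  assumes "c > 0" "x \<ge> 0"
  shows "(\<lambda>i. (1 + x) / ((x + real i + c) * (x + real i + c + 1))) sums ((1 + x) / (x + c))"
proof -
  have lim: "(\<lambda>i. (1 + x) / (x + real i + c)) \<longlonglongrightarrow> 0"
    by real_asymp
  have "(\<lambda>i. (1 + x) / (x + real i + c) - (1 + x) / (x + real (Suc i) + c)) sums
      ((1 + x) / (x + real 0 + c) - 0)"
    by (rule telescope_sums'[OF lim])
  moreover have "(1 + x) / (x + real i + c) - (1 + x) / (x + real (Suc i) + c) =
      (1 + x) / ((x + real i + c) * (x + real i + c + 1))" for i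
  proof -
    have "x + real i + c > 0" using assms by simp
    then show ?thesis by (simp add: divide_simps) (simp add: algebra_simps)
  qed
  ultimately show ?thesis by simp
qed

lemma digit_prob_sums: "x \<ge> 0 \<Longrightarrow> (\<lambda>i. digit_prob i x) sums 1"
  using shifted_reciprocals_telescope[of 1 x] by (simp add: digit_prob_def add_ac)

lemma transfer_ref_fun_sums:
  assumes "x \<ge> 0"
  shows "(\<lambda>i. digit_prob i x * ref_fun (branch i x)) sums ((1 + x) / (x + 2))"
proof -
  have "digit_prob i x * ref_fun (branch i x) = (1 + x) / ((x + real i + 2) * (x + real i + 2 + 1))" for i
  proof -
    have pos: "x + real i + 1 > 0" using assms by simp
    then have "ref_fun (branch i x) = (x + real i + 1) / (x + real i + 3)"
      by (simp add: ref_fun_def branch_def divide_simps)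
    then show ?thesis
      using pos by (simp only:) (simp add: digit_prob_def divide_simps add_ac)
  qed
  then show ?thesis
    using shifted_reciprocals_telescope[of 2 x] assms by simp
qed

lemma transfer_summable:
  assumes "x \<ge> 0" and bnd: "\<And>t. t \<in> {0..1} \<Longrightarrow> \<bar>g t\<bar> \<le> B"
  shows "summable (\<lambda>i. digit_prob i x * g (branch i x))"
proof (rule summable_comparison_test)
  show "summable (\<lambda>i. digit_prob i x * B)"
    using digit_prob_sums[OF assms(1)] by (intro summable_mult2) (rule sums_summable)
  show "\<exists>N. \<forall>i\<ge>N. norm (digit_prob i x * g (branch i x)) \<le> digit_prob i x * B"
    using bnd branch_in_unit[OF assms(1)] digit_prob_nonneg[OF assms(1)]
    by (auto simp: abs_mult intro!: mult_left_mono)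
qed

text \<open>
  The derivative of \<open>digit_prob i\<close> has the sign of \<open>(i + 1)\<^sup>2 - (i + 1) - 1 - 2x - x\<^sup>2\<close>, which on the
  unit interval is negative for \<open>i = 0\<close> and positive for \<open>i \<ge> 2\<close>. Thus the digit 1 loses
  weight, the digits above 2 gain weight, and only the digit 2 behaves irregularly.
\<close>

lemma digit_prob_first_decreasing:
  assumes "0 \<le> x" "x \<le> y"
  shows "digit_prob 0 y \<le> digit_prob 0 x"
  using assms by (simp add: digit_prob_def add.commute divide_simps)

lemma digit_prob_tail_increasing:
  assumes "0 \<le> x" "x \<le> y" "y \<le> 1" "i \<ge> 2"
  shows "digit_prob i x \<le> digit_prob i y"
proof -
  define m where "m = real i"
  have m: "m \<ge> 2" using assms by (simp add: m_def)
  have "x * y \<le> 1" using assms by (simp add: mult_le_one)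
  moreover have "m * m \<ge> 2 * m" using m by (intro mult_right_mono) auto
  ultimately have "m * m + m \<ge> 1 + x + y + x * y" using m assms by linarith
  then have "(y - x) * (m * m + m - 1 - x - y - x * y) \<ge> 0"
    using assms by simp
  then have "(1 + x) * ((y + m + 1) * (y + m + 2)) \<le> (1 + y) * ((x + m + 1) * (x + m + 2))"
    by (simp add: algebra_simps)
  moreover have "(x + m + 1) * (x + m + 2) > 0" "(y + m + 1) * (y + m + 2) > 0"
    using m assms by (simp_all add: mult_pos_pos)
  ultimately show ?thesis
    unfolding digit_prob_def m_def[symmetric] by (simp only: pos_divide_le_eq pos_le_divide_eq times_divide_eq_left)
qed

text \<open>
  Stochastic monotonicity. Subtracting the value at the digit 2 from the integrand is harmless
  because the weights have constant total mass, and it removes the only digit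
  whose weight is not monotone in \<open>x\<close>; every other summand then has the right sign.
\<close>

lemma transfer_mono:
  assumes anti: "antimono_on {0..1} h" and xy: "0 \<le> x" "x \<le> y" "y \<le> 1"
  shows "transfer h x \<le> transfer h y"
proof -
  have hle: "h t \<le> h s" if "0 \<le> s" "s \<le> t" "t \<le> 1" for s t
    using anti that by (auto simp: monotone_on_def)
  define B where "B = \<bar>h 0\<bar> + \<bar>h 1\<bar>"
  have bnd: "\<bar>h t\<bar> \<le> B" if "t \<in> {0..1}" for t
    using hle[of 0 t] hle[of t 1] that by (auto simp: B_def)
  have y0: "0 \<le> y" using xy by simp
  have B0: "\<bar>h (branch i x)\<bar> \<le> B" for i
    using bnd branch_in_unit xy by blast
  note sx = transfer_summable[of x h B, OF xy(1) bnd]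
  note sy = transfer_summable[of y h B, OF y0 bnd]
  define a where "a i = h (branch i x)" for i
  have a_mono: "a i \<le> a j" if "i \<le> j" for i j
    unfolding a_def using xy that branch_in_unit[OF xy(1)]
    by (intro hle) (auto simp: branch_def intro!: divide_left_mono mult_pos_pos)
  have smid: "summable (\<lambda>i. digit_prob i y * a i)"
  proof (rule summable_comparison_test)
    show "summable (\<lambda>i. digit_prob i y * B)"
      using digit_prob_sums[OF y0] by (intro summable_mult2) (rule sums_summable)
    show "\<exists>N. \<forall>i\<ge>N. norm (digit_prob i y * a i) \<le> digit_prob i y * B"
      using B0 digit_prob_nonneg[OF y0]
      by (auto simp: abs_mult a_def intro!: mult_left_mono)
  qed
  have term_nonneg: "(digit_prob i y - digit_prob i x) * (a i - a 1) \<ge> 0" for i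
  proof -
    consider "i = 0" | "i = 1" | "i \<ge> 2" by linarith
    then show ?thesis
    proof cases
      case 1
      then show ?thesis
        using digit_prob_first_decreasing[OF xy(1,2)] a_mono[of 0 1]
        by (simp add: mult_nonpos_nonpos)
    next
      case 3
      then show ?thesis
        using digit_prob_tail_increasing[OF xy 3] a_mono[of 1 i] by simp
    qed simp
  qed
  have "(\<lambda>i. (digit_prob i y * a i - digit_prob i x * a i) - (digit_prob i y - digit_prob i x) * a 1)
      sums (((\<Sum>i. digit_prob i y * a i) - transfer h x) - (1 - 1) * a 1)"
    unfolding transfer_def a_def[symmetric]
    using sx smid digit_prob_sums[OF xy(1)] digit_prob_sums[OF y0]
    by (intro sums_diff sums_mult2) (auto simp: a_def summable_sums)
  then have "0 \<le> ((\<Sum>i. digit_prob i y * a i) - transfer h x) - (1 - 1) * a 1"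
    by (rule sums_le[OF _ sums_zero, rotated]) (use term_nonneg in \<open>simp add: algebra_simps\<close>)
  moreover have "(\<Sum>i. digit_prob i y * a i) \<le> transfer h y"
    unfolding transfer_def
  proof (rule suminf_le[OF _ smid sy])
    fix i
    have "branch i y \<le> branch i x"
      using xy by (auto simp: branch_def intro!: divide_left_mono mult_pos_pos)
    then have "a i \<le> h (branch i y)"
      unfolding a_def using branch_in_unit[OF xy(1), of i] branch_in_unit[OF y0, of i]
      by (intro hle) auto
    then show "digit_prob i y * a i \<le> digit_prob i y * h (branch i y)"
      using digit_prob_nonneg[OF y0] by (rule mult_left_mono)
  qed
  ultimately show ?thesis by simp
qed

section \<open>Contraction\<close>

definition ref_lipschitz :: "real \<Rightarrow> (real \<Rightarrow> real) \<Rightarrow> bool" where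
  "ref_lipschitz L g \<longleftrightarrow> (\<forall>x y. 0 \<le> x \<longrightarrow> x \<le> y \<longrightarrow> y \<le> 1 \<longrightarrow> \<bar>g x - g y\<bar> \<le> L * (ref_fun x - ref_fun y))"

lemma ref_fun_diff:
  assumes "0 \<le> x" "0 \<le> y"
  shows "ref_fun x - ref_fun y = 2 * (y - x) / ((1 + 2 * x) * (1 + 2 * y))"
  using assms by (simp add: ref_fun_def divide_simps)

lemma ref_lipschitzD:
  assumes g: "ref_lipschitz L g" and L: "0 \<le> L" and xy: "x \<in> {0..1}" "y \<in> {0..1}"
  shows "\<bar>g x - g y\<bar> \<le> L"
proof -
  have *: "\<bar>g s - g t\<bar> \<le> L" if st: "0 \<le> s" "s \<le> t" "t \<le> 1" for s t
  proof -
    have "ref_fun s \<le> 1" "ref_fun t \<ge> 0" using st by (auto simp: ref_fun_def)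
    then have "L * (ref_fun s - ref_fun t) \<le> L * 1" using L by (intro mult_left_mono) auto
    moreover have "\<bar>g s - g t\<bar> \<le> L * (ref_fun s - ref_fun t)"
      using g st unfolding ref_lipschitz_def by blast
    ultimately show ?thesis by linarith
  qed
  show ?thesis
    using *[of x y] *[of y x] xy by (cases "x \<le> y") auto
qed

lemma ref_lipschitz_imp_bounded:
  assumes "ref_lipschitz L g" "0 \<le> L"
  obtains B where "\<And>t. t \<in> {0..1} \<Longrightarrow> \<bar>g t\<bar> \<le> B"
proof -
  have "\<bar>g t\<bar> \<le> \<bar>g 0\<bar> + L" if "t \<in> {0..1}" for t
    using ref_lipschitzD[OF assms that, of 0] by auto
  then show ?thesis by (rule that)
qed

text \<open>
  The two signs \<open>c = 1\<close> and \<open>c = -1\<close> give the two halves of the absolute value bound.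
  The closing estimate compares \<open>1/((2+x)(2+y))\<close> with \<open>1/((1+2x)(1+2y))\<close> and uses
  \<open>1 + 2x \<le> 2 + x\<close>, which is an equality at \<open>x = 1\<close>: the factor one half is sharp there.
\<close>

lemma transfer_contracts:
  assumes g: "ref_lipschitz L g" and L: "0 \<le> L"
  shows "ref_lipschitz (L / 2) (transfer g)"
  unfolding ref_lipschitz_def
proof (intro allI impI)
  fix x y :: real
  assume xy: "0 \<le> x" "x \<le> y" "y \<le> 1"
  then have y0: "0 \<le> y" by simp
  obtain B where bnd: "\<And>t. t \<in> {0..1} \<Longrightarrow> \<bar>g t\<bar> \<le> B"
    using ref_lipschitz_imp_bounded[OF g L] by blast
  have signed: "c * (transfer g x - transfer g y) \<le> L * ((1 + y) / (y + 2) - (1 + x) / (x + 2))"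
    if c: "c = 1 \<or> c = -1" for c :: real
  proof -
    define h where "h t = L * ref_fun t + c * g t" for t
    have "h t \<le> h s" if st: "0 \<le> s" "s \<le> t" "t \<le> 1" for s t
    proof -
      have "\<bar>g s - g t\<bar> \<le> L * (ref_fun s - ref_fun t)"
        using g st unfolding ref_lipschitz_def by blast
      then show ?thesis using c by (auto simp: h_def algebra_simps)
    qed
    then have "antimono_on {0..1} h" by (auto simp: monotone_on_def)
    then have "transfer h x \<le> transfer h y" using xy by (rule transfer_mono)
    moreover have "transfer h z = L * ((1 + z) / (z + 2)) + c * transfer g z" if z: "0 \<le> z" for z
    proof -
      have "(\<lambda>i. L * (digit_prob i z * ref_fun (branch i z)) + c * (digit_prob i z * g (branch i z)))
          sums (L * ((1 + z) / (z + 2)) + c * transfer g z)"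
        unfolding transfer_def
        by (intro sums_add sums_mult transfer_ref_fun_sums z summable_sums transfer_summable[OF z bnd])
      then show ?thesis
        unfolding transfer_def h_def by (simp add: sums_iff algebra_simps)
    qed
    ultimately show ?thesis using xy y0 by (simp add: algebra_simps)
  qed
  have "\<bar>transfer g x - transfer g y\<bar> \<le> L * ((1 + y) / (y + 2) - (1 + x) / (x + 2))"
    using signed[of 1] signed[of "-1"] by (simp add: abs_le_iff)
  also have "(1 + y) / (y + 2) - (1 + x) / (x + 2) = (y - x) / ((x + 2) * (y + 2))"
    using xy by (simp add: divide_simps) (simp add: algebra_simps)
  also have "\<dots> \<le> (y - x) / ((1 + 2 * x) * (1 + 2 * y))"
    using xy by (intro divide_left_mono mult_mono mult_pos_pos) auto
  also have "\<dots> = (ref_fun x - ref_fun y) / 2"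
    unfolding ref_fun_diff[OF xy(1) y0] by (simp del: right_diff_distrib_numeral)
  finally show "\<bar>transfer g x - transfer g y\<bar> \<le> L / 2 * (ref_fun x - ref_fun y)"
    using L by (simp add: mult_left_mono)
qed

section \<open>From distribution functions to densities\<close>

text \<open>
  The density relative to the invariant measure \<open>dx/(1+x)\<close> of the Gauss map, together with
  the boundary values of a distribution function, is what the recursion propagates.
\<close>

definition has_density :: "(real \<Rightarrow> real) \<Rightarrow> (real \<Rightarrow> real) \<Rightarrow> bool" where
  "has_density F g \<longleftrightarrow> F 0 = 0 \<and> F 1 = 1 \<and>
     (\<forall>x\<in>{0..1}. (F has_real_derivative g x / (1 + x)) (at x within {0..1}))"

lemma branch_summand_deriv:
  assumes F: "\<And>t. t \<in> {0..1} \<Longrightarrow> (F has_real_derivative g t / (1 + t)) (at t within {0..1})"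
    and x: "x \<in> {0..1}"
  shows "((\<lambda>x. F (branch i 0) - F (branch i x)) has_real_derivative
      digit_prob i x * g (branch i x) / (1 + x)) (at x within {0..1})"
proof -
  have s: "x + real i + 1 > 0" using x by simp
  have b: "branch i x \<in> {0..1}" using branch_in_unit x by simp
  have "(branch i has_real_derivative - 1 / (x + real i + 1)\<^sup>2) (at x within {0..1})"
    unfolding branch_def using s
    by (auto intro!: derivative_eq_intros simp: power2_eq_square)
  moreover have "(F has_real_derivative g (branch i x) / (1 + branch i x))
      (at (branch i x) within branch i ` {0..1})"
    using F[OF b] by (rule DERIV_subset) (use branch_in_unit in auto)
  ultimately have "((F \<circ> branch i) has_real_derivative
      g (branch i x) / (1 + branch i x) * (- 1 / (x + real i + 1)\<^sup>2)) (at x within {0..1})"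
    by (rule DERIV_image_chain[rotated])
  then have "((\<lambda>x. F (branch i 0) - F (branch i x)) has_real_derivative
      0 - g (branch i x) / (1 + branch i x) * (- 1 / (x + real i + 1)\<^sup>2)) (at x within {0..1})"
    unfolding o_def by (intro derivative_intros)
  moreover have "1 + branch i x = (x + real i + 2) / (x + real i + 1)"
    using s by (simp add: branch_def divide_simps)
  then have "0 - g (branch i x) / (1 + branch i x) * (- 1 / (x + real i + 1)\<^sup>2) =
      digit_prob i x * g (branch i x) / (1 + x)"
    using s x by (simp only:) (simp add: digit_prob_def divide_simps power2_eq_square)
  ultimately show ?thesis by simp
qed

lemma recursion_transfers_density:
  assumes F: "has_density F g" and bnd: "\<And>t. t \<in> {0..1} \<Longrightarrow> \<bar>g t\<bar> \<le> B"
    and G: "\<And>x. x \<in> {0..1} \<Longrightarrow> G x = (\<Sum>i. F (branch i 0) - F (branch i x))"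
  shows "has_density G (transfer g)"
proof -
  have F0: "F 0 = 0" and F1: "F 1 = 1"
    and F': "\<And>t. t \<in> {0..1} \<Longrightarrow> (F has_real_derivative g t / (1 + t)) (at t within {0..1})"
    using F by (auto simp: has_density_def)
  define d where "d i x = digit_prob i x * g (branch i x) / (1 + x)" for i x
  have B: "B \<ge> 0" using bnd[of 0] by auto
  have unif: "uniform_limit {0..1} (\<lambda>n x. \<Sum>i<n. d i x) (\<lambda>x. \<Sum>i. d i x) sequentially"
  proof (rule Weierstrass_m_test)
    show "summable (\<lambda>i. digit_prob i 0 * B)"
      using digit_prob_sums[of 0] by (intro summable_mult2) (auto intro: sums_summable)
    fix i and x :: real
    assume x: "x \<in> {0..1}"
    have "digit_prob i x / (1 + x) = 1 / ((x + real i + 1) * (x + real i + 2))"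
      using x by (simp add: digit_prob_def)
    also have "\<dots> \<le> digit_prob i 0"
      unfolding digit_prob_def using x
      by (simp only: add_0_left add_0_right) (intro divide_left_mono mult_mono mult_pos_pos; simp)
    finally have "digit_prob i x / (1 + x) \<le> digit_prob i 0" .
    moreover have "\<bar>g (branch i x)\<bar> \<le> B" using bnd branch_in_unit x by simp
    moreover have "\<bar>d i x\<bar> = digit_prob i x / (1 + x) * \<bar>g (branch i x)\<bar>"
      using x digit_prob_nonneg[of x i] by (simp add: d_def abs_mult)
    ultimately show "norm (d i x) \<le> digit_prob i 0 * B"
      unfolding real_norm_def by (simp only:) (intro mult_mono; simp add: digit_prob_nonneg)
  qed
  have "\<exists>H. \<forall>x\<in>{0..1}. (\<lambda>i. F (branch i 0) - F (branch i x)) sums H x \<and>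
      (H has_real_derivative (\<Sum>i. d i x)) (at x within {0..1})"
  proof (rule has_field_derivative_series[OF _ _ unif])
    show "((\<lambda>x. F (branch i 0) - F (branch i x)) has_real_derivative d i x) (at x within {0..1})"
      if "x \<in> {0..1}" for i x
      unfolding d_def using F' that by (rule branch_summand_deriv)
    show "(0::real) \<in> {0..1}" by simp
  qed auto
  then obtain H where H: "\<And>x. x \<in> {0..1} \<Longrightarrow> (\<lambda>i. F (branch i 0) - F (branch i x)) sums H x"
    and H': "\<And>x. x \<in> {0..1} \<Longrightarrow> (H has_real_derivative (\<Sum>i. d i x)) (at x within {0..1})"
    by blast
  have GH: "G x = H x" if "x \<in> {0..1}" for x
    using G[OF that] H[OF that] by (simp add: sums_iff)
  have "(G has_real_derivative transfer g x / (1 + x)) (at x within {0..1})"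
    if x: "x \<in> {0..1}" for x
  proof -
    have "summable (\<lambda>i. digit_prob i x * g (branch i x))"
      using x bnd by (intro transfer_summable) auto
    then have "(\<Sum>i. d i x) = transfer g x / (1 + x)"
      unfolding d_def transfer_def by (simp add: suminf_divide)
    then show ?thesis
      using H'[OF x] has_field_derivative_transform_within[of H _ x "{0..1}" 1 G] GH x by auto
  qed
  moreover have "G 0 = 0" using G[of 0] by simp
  moreover have "G 1 = 1"
  proof -
    have "continuous_on {0..1} F"
      using F' by (rule DERIV_continuous_on)
    moreover have "(\<lambda>i. branch i 0) \<longlonglongrightarrow> 0"
      unfolding branch_def by real_asymp
    ultimately have "(\<lambda>i. F (branch i 0)) \<longlonglongrightarrow> F 0"
      by (rule continuous_on_tendsto_compose) (use branch_in_unit in auto)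
    then have "(\<lambda>i. F (branch i 0) - F (branch (Suc i) 0)) sums (F (branch 0 0) - F 0)"
      by (rule telescope_sums')
    moreover have "branch (Suc i) 0 = branch i 1" for i
      by (simp add: branch_def add_ac)
    moreover have "branch 0 0 = 1" by (simp add: branch_def)
    ultimately show ?thesis using G[of 1] F0 F1 by (simp add: sums_iff)
  qed
  ultimately show ?thesis by (simp add: has_density_def)
qed

text \<open>
  Rolle's theorem supplies a point where the density equals that of the Gauss measure; the
  small oscillation then makes it close everywhere.
\<close>

lemma deviation_from_log:
  assumes F: "has_density F g" and g: "ref_lipschitz L g" and L: "0 \<le> L"
    and x: "x \<in> {0..1}"
  shows "\<bar>F x - ln (x + 1) / ln 2\<bar> \<le> L"
proof -
  define h where "h t = F t - ln (t + 1) / ln 2" for t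
  have h': "(h has_real_derivative (g t - 1 / ln 2) / (1 + t)) (at t within {0..1})"
    if t: "t \<in> {0..1}" for t
  proof -
    have "(h has_real_derivative g t / (1 + t) - 1 / (t + 1) / ln 2) (at t within {0..1})"
      unfolding h_def using F t by (auto simp: has_density_def intro!: derivative_eq_intros)
    moreover have "g t / (1 + t) - 1 / (t + 1) / ln 2 = (g t - 1 / ln 2) / (1 + t)"
      using t by (simp add: diff_divide_distrib add.commute)
    ultimately show ?thesis by simp
  qed
  have h0: "h 0 = 0" and h1: "h 1 = 0"
    using F by (auto simp: h_def has_density_def)
  have mvt: "\<exists>\<xi>\<in>{0..1}. h b - h 0 = b * ((g \<xi> - 1 / ln 2) / (1 + \<xi>))" if b: "b \<in> {0<..1}" for b
  proof -
    have "\<exists>\<xi>. 0 < \<xi> \<and> \<xi> < b \<and> h b - h 0 = (b - 0) * ((g \<xi> - 1 / ln 2) / (1 + \<xi>))"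
    proof -
      have "(h has_derivative (*) ((g t - 1 / ln 2) / (1 + t))) (at t within {0..b})"
        if "0 \<le> t" "t \<le> b" for t
        using DERIV_subset[OF h'[of t], of "{0..b}"] that b by (auto simp: has_field_derivative_def)
      then show ?thesis
        using mvt_simple[of 0 b h "\<lambda>t. (*) ((g t - 1 / ln 2) / (1 + t))"] b
        by (auto simp: mult.commute)
    qed
    then show ?thesis using b by force
  qed
  obtain \<xi> where \<xi>: "\<xi> \<in> {0..1}" "g \<xi> = 1 / ln 2"
    using mvt[of 1] h0 h1 by auto
  show ?thesis
  proof (cases "x = 0")
    case True
    then show ?thesis using h0 L by (simp add: h_def)
  next
    case False
    then obtain \<eta> where \<eta>: "\<eta> \<in> {0..1}" "h x = x * ((g \<eta> - 1 / ln 2) / (1 + \<eta>))"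
      using mvt[of x] x h0 by auto
    have "\<bar>g \<eta> - 1 / ln 2\<bar> \<le> L"
      using ref_lipschitzD[OF g L \<eta>(1) \<xi>(1)] \<xi>(2) by simp
    then have "\<bar>g \<eta> - 1 / ln 2\<bar> / (1 + \<eta>) \<le> L / 1"
      using \<eta> L by (intro frac_le) auto
    then have "x * (\<bar>g \<eta> - 1 / ln 2\<bar> / (1 + \<eta>)) \<le> 1 * L"
      using x \<eta> L by (intro mult_mono) auto
    then show ?thesis
      using \<eta> x unfolding h_def[symmetric] by (simp add: abs_mult)
  qed
qed

lemma bounded_second_deriv_imp_ref_lipschitz:
  fixes F F' F'' :: "real \<Rightarrow> real"
  assumes F': "\<And>x. x \<in> {0..1} \<Longrightarrow> (F has_real_derivative F' x) (at x within {0..1})"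
    and F'': "\<And>x. x \<in> {0..1} \<Longrightarrow> (F' has_real_derivative F'' x) (at x within {0..1})"
    and bnd: "bounded (F'' ` {0..1})" and F0: "F 0 = 0" and F1: "F 1 = 1"
  obtains L where "0 \<le> L" "has_density F (\<lambda>x. (1 + x) * F' x)" "ref_lipschitz L (\<lambda>x. (1 + x) * F' x)"
proof -
  define g where "g x = (1 + x) * F' x" for x
  have "bounded (F' ` {0..1})"
    using DERIV_continuous_on[OF F''] by (intro compact_imp_bounded compact_continuous_image) auto
  then obtain B1 where B1: "\<And>x. x \<in> {0..1} \<Longrightarrow> \<bar>F' x\<bar> \<le> B1"
    unfolding bounded_iff by fastforce
  obtain B2 where B2: "\<And>x. x \<in> {0..1} \<Longrightarrow> \<bar>F'' x\<bar> \<le> B2"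
    using bnd unfolding bounded_iff by fastforce
  define K where "K = B1 + 2 * B2"
  have K0: "K \<ge> 0" using B1[of 0] B2[of 0] by (auto simp: K_def)
  have g': "(g has_real_derivative F' x + (1 + x) * F'' x) (at x within {0..1})"
    if "x \<in> {0..1}" for x
    unfolding g_def using F''[OF that] by (auto intro!: derivative_eq_intros)
  have g'_bound: "norm (F' x + (1 + x) * F'' x) \<le> K" if x: "x \<in> {0..1}" for x
  proof -
    have "\<bar>(1 + x) * F'' x\<bar> \<le> 2 * B2"
      unfolding abs_mult using x B2[OF x] by (intro mult_mono) auto
    then show ?thesis using B1[OF x] unfolding K_def by simp
  qed
  have "ref_lipschitz (9 / 2 * K) g"
    unfolding ref_lipschitz_def
  proof (intro allI impI)
    fix x y :: real
    assume xy: "0 \<le> x" "x \<le> y" "y \<le> 1"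
    have "norm (g x - g y) \<le> K * norm (x - y)"
      by (rule field_differentiable_bound[OF _ g' g'_bound]) (use xy in auto)
    then have "\<bar>g x - g y\<bar> \<le> K * (y - x)" using xy by simp
    moreover have "(1 + 2 * x) * (1 + 2 * y) \<le> 3 * 3"
      using xy by (intro mult_mono) auto
    then have "2 * (y - x) / 9 \<le> 2 * (y - x) / ((1 + 2 * x) * (1 + 2 * y))"
      using xy by (intro divide_left_mono mult_pos_pos) auto
    then have "2 * (y - x) / 9 \<le> ref_fun x - ref_fun y"
      using xy by (subst ref_fun_diff) auto
    then have "y - x \<le> 9 / 2 * (ref_fun x - ref_fun y)" by simp
    then have "K * (y - x) \<le> K * (9 / 2 * (ref_fun x - ref_fun y))"
      using K0 by (rule mult_left_mono)
    ultimately show "\<bar>g x - g y\<bar> \<le> 9 / 2 * K * (ref_fun x - ref_fun y)"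
      by (simp only: mult.assoc mult.left_commute[of K])
  qed
  moreover have "has_density F g"
    using F' F0 F1 by (auto simp: has_density_def g_def)
  ultimately show ?thesis
    using K0 that[of "9 / 2 * K"] unfolding g_def by simp
qed

section \<open>The rate of convergence\<close>

theorem mainTheorem1:
  "\<exists>q::real. 0 < q \<and> q < 1 \<and> 0.7594 \<le> q \<and> q < 0.7595 \<and>
     (\<forall>f :: nat \<Rightarrow> real \<Rightarrow> real.
        (\<exists>f' f''.
           (\<forall>x\<in>{0..1}. (f 0 has_real_derivative f' x) (at x within {0..1})) \<and>
           (\<forall>x\<in>{0..1}. (f' has_real_derivative f'' x) (at x within {0..1})) \<and>
           bounded (f'' ` {0..1})) \<longrightarrow>
        f 0 0 = 0 \<longrightarrow> f 0 1 = 1 \<longrightarrow>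
        (\<forall>n. \<forall>x\<in>{0..1}. f (Suc n) x =
           (\<Sum>i. f n (1 / real (Suc i)) - f n (1 / (x + real (Suc i))))) \<longrightarrow>
        (\<exists>C. \<forall>n. \<forall>x\<in>{0..1}. \<bar>f n x - ln (x + 1) / ln 2\<bar> \<le> C * q ^ n))"
proof (rule exI[of _ "0.7594"], intro conjI allI impI)
  fix f :: "nat \<Rightarrow> real \<Rightarrow> real"
  assume smooth: "\<exists>f' f''.
      (\<forall>x\<in>{0..1}. (f 0 has_real_derivative f' x) (at x within {0..1})) \<and>
      (\<forall>x\<in>{0..1}. (f' has_real_derivative f'' x) (at x within {0..1})) \<and>
      bounded (f'' ` {0..1})"
    and ends: "f 0 0 = 0" "f 0 1 = 1"
    and rec: "\<forall>n. \<forall>x\<in>{0..1}. f (Suc n) x =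
      (\<Sum>i. f n (1 / real (Suc i)) - f n (1 / (x + real (Suc i))))"
  obtain f' f'' where f': "\<forall>x\<in>{0..1}. (f 0 has_real_derivative f' x) (at x within {0..1})"
      "\<forall>x\<in>{0..1}. (f' has_real_derivative f'' x) (at x within {0..1})" "bounded (f'' ` {0..1})"
    using smooth by blast
  obtain L where L: "0 \<le> L" and init: "has_density (f 0) (\<lambda>x. (1 + x) * f' x)"
      "ref_lipschitz L (\<lambda>x. (1 + x) * f' x)"
    by (rule bounded_second_deriv_imp_ref_lipschitz[of "f 0" f' f'']) (use f' ends in auto)
  have step: "f (Suc n) x = (\<Sum>i. f n (branch i 0) - f n (branch i x))" if "x \<in> {0..1}" for n x
    using rec that by (simp add: branch_def add_ac)
  have densities: "\<exists>g. has_density (f n) g \<and> ref_lipschitz (L * (1 / 2) ^ n) g" for n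
  proof (induction n)
    case 0
    then show ?case using init by auto
  next
    case (Suc n)
    then obtain g where g: "has_density (f n) g" "ref_lipschitz (L * (1 / 2) ^ n) g" by blast
    have Ln: "0 \<le> L * (1 / 2) ^ n" using L by simp
    obtain B where "\<And>t. t \<in> {0..1} \<Longrightarrow> \<bar>g t\<bar> \<le> B"
      using ref_lipschitz_imp_bounded[OF g(2) Ln] by blast
    then have "has_density (f (Suc n)) (transfer g)"
      using step by (rule recursion_transfers_density[OF g(1)])
    moreover have "ref_lipschitz (L * (1 / 2) ^ Suc n) (transfer g)"
      using transfer_contracts[OF g(2) Ln] by simp
    ultimately show ?case by blast
  qed
  have "\<bar>f n x - ln (x + 1) / ln 2\<bar> \<le> L * 0.7594 ^ n" if x: "x \<in> {0..1}" for n x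
  proof -
    obtain g where "has_density (f n) g" "ref_lipschitz (L * (1 / 2) ^ n) g"
      using densities by blast
    then have "\<bar>f n x - ln (x + 1) / ln 2\<bar> \<le> L * (1 / 2) ^ n"
      by (rule deviation_from_log) (use L x in auto)
    also have "\<dots> \<le> L * 0.7594 ^ n"
      using L by (intro mult_left_mono power_mono) auto
    finally show ?thesis .
  qed
  then show "\<exists>C. \<forall>n. \<forall>x\<in>{0..1}. \<bar>f n x - ln (x + 1) / ln 2\<bar> \<le> C * 0.7594 ^ n"
    by blast
qed auto

end
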